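(* Let $\lambda,\mu>0$ and $x^*\in\Omega$. Then the following statements hold. (i) If $x^*$ is a global minimizer of $\min_{x\in\mathbb{R}^n}\phi(x)$, then $x^*$ is a support optimal (SO) point of this problem. (ii) If $f$ is convex and $x^*$ is an SO point of $\min_{x\in\mathbb{R}^n}\phi(x)$, then $x^*$ is a local minimizer of $\min_{x\in\mathbb{R}^n}\phi(x)$.
   Context: The index set $\{1,\dots,n\}$ is partitioned into pairwise disjoint groups $G_1,\dots,G_q$ with $\cup_{i=1}^q G_i=\{1,\dots,n\}$, $q\in\{1,\dots,n\}$; $x_{G_i}$ is the sub-vector of $x\in\mathbb{R}^n$ restricted to $G_i$. $\|\cdot\|$ is the Euclidean norm, $\|x\|_0$ is the number of nonzero entries of $x$, $\|x\|_{2,0}$ is the number of indices $i$ with $\|x_{G_i}\|\neq 0$, and $\mathrm{supp}(x)$ is the set of indices of nonzero entries of $x$. The box is $\Omega=\{x\in\mathbb{R}^n : -l\le x\le u\}$ with $l,u\in\mathbb{R}^n$, $l,u\ge 0$; $\delta_\Omega$ is its indicator function ($0$ on $\Omega$, $+\infty$ outside). $f:\mathbb{R}^n\to\mathbb{R}$ is smooth and bounded from below on $\Omega$. Define $\phi(x)=f(x)+\lambda\|x\|_0+\mu\|x\|_{2,0}+\delta_\Omega(x)$. A vector $x^*\in\Omega$ is a support optimal (SO) point of $\min\phi$ if $x^*$ is a global minimizer of $\min_{x\in\mathbb{X}}f(x)$, where $\mathbb{X}=\{x\in\Omega : \mathrm{supp}(x)\subseteq\mathrm{supp}(x^* )\}$.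 *)

theory Defs
  imports "HOL-Analysis.Analysis"
begin

definition supp :: "real ^ 'n \<Rightarrow> 'n set" where
  "supp x = {i. x $ i \<noteq> 0}"

definition l0_norm :: "real ^ 'n \<Rightarrow> nat" where
  "l0_norm x = card {i. x $ i \<noteq> 0}"

text \<open>
  The groups are \<open>G 1, \<dots>, G q\<close>. They are not required to be nonempty:
  an empty group never contributes to \<open>group_l0_norm\<close>.
\<close>

definition group_partition :: "nat \<Rightarrow> (nat \<Rightarrow> 'n::finite set) \<Rightarrow> bool" where
  "group_partition q G \<longleftrightarrow>
     q \<in> {1..CARD('n)} \<and> disjoint_family_on G {1..q} \<and> (\<Union>i\<in>{1..q}. G i) = UNIV"

text \<open>
  \<open>L2_set (($) x) (G i)\<close> is the Euclidean norm of the sub-vector of \<open>x\<close> with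
  indices in \<open>G i\<close>.
\<close>

definition group_l0_norm :: "nat \<Rightarrow> (nat \<Rightarrow> 'n set) \<Rightarrow> real ^ 'n \<Rightarrow> nat" where
  "group_l0_norm q G x = card {i \<in> {1..q}. L2_set (($) x) (G i) \<noteq> 0}"

text \<open>The order on \<open>real ^ 'n\<close> is componentwise.\<close>

definition Omega :: "real ^ 'n \<Rightarrow> real ^ 'n \<Rightarrow> (real ^ 'n) set" where
  "Omega l u = {x. - l \<le> x \<and> x \<le> u}"

definition delta :: "'a set \<Rightarrow> 'a \<Rightarrow> ereal" where
  "delta S x = (if x \<in> S then 0 else \<infinity>)"

definition phi ::
  "(real ^ 'n \<Rightarrow> real) \<Rightarrow> real \<Rightarrow> real \<Rightarrow> nat \<Rightarrow> (nat \<Rightarrow> 'n set) \<Rightarrow>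
   real ^ 'n \<Rightarrow> real ^ 'n \<Rightarrow> real ^ 'n \<Rightarrow> ereal" where
  "phi f lam mu q G l u x =
     ereal (f x + lam * real (l0_norm x) + mu * real (group_l0_norm q G x)) + delta (Omega l u) x"

text \<open>Smoothness is read as continuous differentiability on the whole space.\<close>

definition smooth :: "('a::real_inner \<Rightarrow> real) \<Rightarrow> bool" where
  "smooth f \<longleftrightarrow> (\<exists>g. (\<forall>x. GDERIV f x :> g x) \<and> continuous_on UNIV g)"

definition global_minimizer_on :: "('a \<Rightarrow> 'b::linorder) \<Rightarrow> 'a set \<Rightarrow> 'a \<Rightarrow> bool" where
  "global_minimizer_on g S x \<longleftrightarrow> is_arg_min g (\<lambda>y. y \<in> S) x"

definition local_minimizer :: "('a::metric_space \<Rightarrow> 'b::linorder) \<Rightarrow> 'a \<Rightarrow> bool" where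
  "local_minimizer g x \<longleftrightarrow> (\<exists>e>0. global_minimizer_on g (ball x e) x)"

definition SO_point ::
  "(real ^ 'n \<Rightarrow> real) \<Rightarrow> real ^ 'n \<Rightarrow> real ^ 'n \<Rightarrow> real ^ 'n \<Rightarrow> bool" where
  "SO_point f l u xs \<longleftrightarrow>
     xs \<in> Omega l u \<and> global_minimizer_on f {x \<in> Omega l u. supp x \<subseteq> supp xs} xs"

end

theory Submission
  imports Defs
begin

text \<open>
  Both counting terms of \<open>phi\<close> are monotone in the support. For (i), a point whose support lies in
  that of the minimizer has no larger penalty, so it cannot have a smaller value of \<open>f\<close>. For (ii),
  every point near \<open>xs\<close> has at least the support of \<open>xs\<close>. If the supports agree, support optimality
  applies; otherwise the penalty grows by at least \<open>lam\<close>, which outweighs the small change of the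
  continuous function \<open>f\<close>.
\<close>

lemma l0_norm_eq_card_supp: "l0_norm x = card (supp x)"
  by (simp add: l0_norm_def supp_def)

lemma l0_norm_mono:
  fixes x y :: "real ^ 'n::finite"
  assumes "supp x \<subseteq> supp y"
  shows "l0_norm x \<le> l0_norm y"
  using assms by (simp add: l0_norm_eq_card_supp card_mono)

lemma l0_norm_strict_mono:
  fixes x y :: "real ^ 'n::finite"
  assumes "supp x \<subset> supp y"
  shows "l0_norm x < l0_norm y"
  using assms by (simp add: l0_norm_eq_card_supp psubset_card_mono)

text \<open>The Euclidean norm over a finite group vanishes exactly when every entry in it does, so
  a group that is nonzero for \<open>x\<close> is also nonzero for \<open>y\<close>.\<close>

lemma group_l0_norm_mono:
  fixes x y :: "real ^ 'n::finite"
  assumes "supp x \<subseteq> supp y"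
  shows "group_l0_norm q G x \<le> group_l0_norm q G y"
  unfolding group_l0_norm_def
proof (rule card_mono)
  show "{i \<in> {1..q}. L2_set (($) x) (G i) \<noteq> 0} \<subseteq> {i \<in> {1..q}. L2_set (($) y) (G i) \<noteq> 0}"
    using assms by (auto simp: supp_def L2_set_eq_0_iff)
qed simp

lemma smooth_imp_isCont:
  assumes "smooth f"
  shows "isCont f x"
  using assms has_derivative_continuous by (fastforce simp: smooth_def gderiv_def)

text \<open>By continuity of coordinates each nonzero entry stays nonzero near \<open>x\<close>; as
  there are finitely many indices, one neighbourhood serves them all.\<close>

lemma eventually_supp_subset:
  fixes x :: "real ^ 'n::finite"
  shows "\<forall>\<^sub>F y in nhds x. supp x \<subseteq> supp y"
proof -
  have "\<forall>\<^sub>F y in nhds x. y $ i \<noteq> 0" if "i \<in> supp x" for i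
  proof (rule tendsto_imp_eventually_ne)
    show "((\<lambda>y. y $ i) \<longlongrightarrow> x $ i) (nhds x)"
      by (intro tendsto_intros filterlim_ident)
    show "x $ i \<noteq> 0"
      using that by (simp add: supp_def)
  qed
  then have "\<forall>\<^sub>F y in nhds x. \<forall>i\<in>supp x. y $ i \<noteq> 0"
    by (simp add: eventually_ball_finite)
  then show ?thesis
    by eventually_elim (auto simp: supp_def)
qed

text \<open>On the box the indicator is zero, so comparisons in \<open>ereal\<close> reduce to real
  arithmetic.\<close>

lemma phi_le_phi_iff:
  assumes "x \<in> Omega l u" "y \<in> Omega l u"
  shows "phi f lam mu q G l u x \<le> phi f lam mu q G l u y \<longleftrightarrow>
    f x + lam * real (l0_norm x) + mu * real (group_l0_norm q G x)
      \<le> f y + lam * real (l0_norm y) + mu * real (group_l0_norm q G y)"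
  using assms by (simp add: phi_def delta_def)

lemma phi_outside:
  assumes "y \<notin> Omega l u"
  shows "phi f lam mu q G l u y = \<infinity>"
  using assms by (simp add: phi_def delta_def)

lemma global_minimizer_on_iff:
  "global_minimizer_on g S x \<longleftrightarrow> x \<in> S \<and> (\<forall>y\<in>S. g x \<le> g y)"
  by (auto simp: global_minimizer_on_def is_arg_min_linorder)

text \<open>The filter form lets several neighbourhood conditions be combined without choosing
  radii.\<close>

lemma local_minimizer_iff_eventually:
  "local_minimizer g x \<longleftrightarrow> (\<forall>\<^sub>F y in nhds x. g x \<le> g y)"
  by (auto simp: local_minimizer_def global_minimizer_on_iff eventually_nhds_metric dist_commute)

lemma global_minimizer_imp_SO_point:
  fixes f :: "real ^ 'n::finite \<Rightarrow> real"
  assumes min: "global_minimizer_on (phi f lam mu q G l u) UNIV xs"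
    and lam: "lam \<ge> 0" and mu: "mu \<ge> 0" and xs: "xs \<in> Omega l u"
  shows "SO_point f l u xs"
proof -
  have "f xs \<le> f y" if y: "y \<in> Omega l u" and supp: "supp y \<subseteq> supp xs" for y
  proof -
    have "phi f lam mu q G l u xs \<le> phi f lam mu q G l u y"
      using min by (simp add: global_minimizer_on_iff)
    then have "f xs + lam * real (l0_norm xs) + mu * real (group_l0_norm q G xs)
        \<le> f y + lam * real (l0_norm y) + mu * real (group_l0_norm q G y)"
      by (simp add: phi_le_phi_iff xs y)
    moreover have "lam * real (l0_norm y) \<le> lam * real (l0_norm xs)"
      using lam l0_norm_mono[OF supp] by (simp add: mult_left_mono)
    moreover have "mu * real (group_l0_norm q G y) \<le> mu * real (group_l0_norm q G xs)"
      using mu group_l0_norm_mono[OF supp] by (simp add: mult_left_mono)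
    ultimately show ?thesis
      by linarith
  qed
  with xs show ?thesis
    by (simp add: SO_point_def global_minimizer_on_iff)
qed

lemma SO_point_imp_local_minimizer:
  fixes f :: "real ^ 'n::finite \<Rightarrow> real"
  assumes SO: "SO_point f l u xs" and cont: "isCont f xs"
    and lam: "lam > 0" and mu: "mu \<ge> 0"
  shows "local_minimizer (phi f lam mu q G l u) xs"
proof -
  have xs: "xs \<in> Omega l u"
    using SO by (simp add: SO_point_def)
  have "(f \<longlongrightarrow> f xs) (nhds xs)"
    using cont by (simp add: continuous_at tendsto_at_iff_tendsto_nhds)
  \<comment> \<open>The tolerance \<open>lam\<close> is the price of one additional nonzero
    entry.\<close>
  then have "\<forall>\<^sub>F y in nhds xs. f xs - lam < f y"
    using lam by (intro order_tendstoD(1)) auto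
  then have "\<forall>\<^sub>F y in nhds xs. phi f lam mu q G l u xs \<le> phi f lam mu q G l u y"
    using eventually_supp_subset[of xs]
  proof eventually_elim
    case (elim y)
    show ?case
    proof (cases "y \<in> Omega l u")
      case True
      have l0: "f xs + lam * real (l0_norm xs) \<le> f y + lam * real (l0_norm y)"
      proof (cases "supp y \<subseteq> supp xs")
        case True
        then have "f xs \<le> f y"
          using SO \<open>y \<in> Omega l u\<close> by (simp add: SO_point_def global_minimizer_on_iff)
        then show ?thesis
          \<comment> \<open>Both inclusions hold, so the supports coincide and the
            \<open>l0_norm\<close> terms cancel.\<close>
          using \<open>supp y \<subseteq> supp xs\<close> elim(2) by (simp add: l0_norm_eq_card_supp subset_antisym)
      next
        case False
        \<comment> \<open>The counts are integers, so a strictly larger support adds at least one;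
          the resulting \<open>lam\<close> covers the possible drop in \<open>f\<close>.\<close>
        then have "real (l0_norm xs) + 1 \<le> real (l0_norm y)"
          using elim(2) l0_norm_strict_mono[of xs y] by fastforce
        then have "lam * (real (l0_norm xs) + 1) \<le> lam * real (l0_norm y)"
          using lam by (intro mult_left_mono) auto
        then show ?thesis
          using elim(1) by (simp add: distrib_left)
      qed
      \<comment> \<open>Monotonicity is enough for the group term, since the strict gain already
        comes from \<open>l0_norm\<close>.\<close>
      have "mu * real (group_l0_norm q G xs) \<le> mu * real (group_l0_norm q G y)"
        using mu group_l0_norm_mono[OF elim(2)] by (simp add: mult_left_mono)
      with l0 show ?thesis
        by (simp add: phi_le_phi_iff xs True)
    \<comment> \<open>Outside the box the right-hand side is infinite.\<close>
    qed (simp add: phi_outside)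
  qed
  then show ?thesis
    by (simp add: local_minimizer_iff_eventually)
qed

theorem lemma3p1:
  fixes f :: "real ^ 'n::finite \<Rightarrow> real"
    and l u xs :: "real ^ 'n"
    and lam mu :: real
    and q :: nat
    and G :: "nat \<Rightarrow> 'n set"
  assumes "group_partition q G"
    and "0 \<le> l" and "0 \<le> u"
    and "smooth f"
    and "bdd_below (f ` Omega l u)"
    and "lam > 0" and "mu > 0"
    and "xs \<in> Omega l u"
  shows "(global_minimizer_on (phi f lam mu q G l u) UNIV xs \<longrightarrow> SO_point f l u xs)
    \<and> (convex_on UNIV f \<and> SO_point f l u xs \<longrightarrow> local_minimizer (phi f lam mu q G l u) xs)"
  using assms
  by (auto intro: global_minimizer_imp_SO_point SO_point_imp_local_minimizer smooth_imp_isCont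
      less_imp_le)

end
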